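(* Let $X$ be a complex Banach space and let $T\in\mathcal{B}(X)$ be such that $\{1\}\subseteq\sigma(T)\cap\mathbb{T}\subseteq\mathbb{D}\cup\{1\}$. Further let $m\colon(0,\pi]\to(0,\infty)$ be a continuous non-increasing function and suppose that $\|R(e^{i\theta},T)\|\le m(|\theta|)$ for $0<|\theta|\le\pi$ and that $$\max_{\varepsilon\le|\theta|\le\pi}\frac{1}{\operatorname{dist}(e^{i\theta},\sigma(T))}\ge\delta m(\varepsilon),\quad 0<\varepsilon\le\pi,$$ for some $\delta\in(0,1]$. If $$\|T^n(I-T)\|=O\big(m^{-1}(cn)\big),\quad n\to\infty,$$ for some $c>0$, then $m$ has reciprocally positive increase.
   Context: $\mathcal{B}(X)$ is the algebra of bounded linear operators on $X$, $\sigma(T)$ is the spectrum of $T$, $\mathbb{T}=\{\lambda\in\mathbb{C}:|\lambda|=1\}$, $\mathbb{D}=\{\lambda\in\mathbb{C}:|\lambda|<1\}$, and $R(\lambda,T)=(\lambda-T)^{-1}$ for $\lambda$ in the resolvent set of $T$. For a continuous non-increasing function $m\colon(0,\pi]\to(0,\infty)$ with $m(\varepsilon)\to\infty$ as $\varepsilon\to0+$, the right-inverse $m^{-1}$ is defined by $m^{-1}(s)=\inf\{\varepsilon\in(0,\pi]:m(\varepsilon)\le s\}$ for $s\ge m(\pi)$. (Here $m(\varepsilon)\to\infty$ as $\varepsilon\to0+$ holds automatically since $1\in\sigma(T)$ gives $m(\varepsilon)\ge\|R(e^{i\varepsilon},T)\|\ge\varepsilon^{-1}$; thus $m^{-1}(cn)$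 is defined for all sufficiently large $n$.) A function $m\colon(0,\pi]\to(0,\infty)$ has reciprocally positive increase if there exist constants $c_0\in(0,1]$, $\alpha>0$ and $\varepsilon_0\in(0,\pi]$ such that $\dfrac{m(t^{-1}\varepsilon)}{m(\varepsilon)}\ge c_0t^\alpha$ for all $t\ge1$ and $0<\varepsilon\le\varepsilon_0$. *)

theory Defs
  imports "HOL-Analysis.Analysis" "HOL-Library.Landau_Symbols"
begin

text \<open>Complex Banach spaces: a Banach space (over the reals) whose real scalar multiplication is
  the restriction of a complex one, with the norm homogeneous over the complex numbers.\<close>

class complex_banach = banach +
  fixes scaleC :: "complex \<Rightarrow> 'a \<Rightarrow> 'a" (infixr "*\<^sub>C" 75)
  assumes scaleC_add_right: "a *\<^sub>C (x + y) = a *\<^sub>C x + a *\<^sub>C y"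
    and scaleC_add_left: "(a + b) *\<^sub>C x = a *\<^sub>C x + b *\<^sub>C x"
    and scaleC_scaleC: "a *\<^sub>C b *\<^sub>C x = (a * b) *\<^sub>C x"
    and scaleC_of_real: "complex_of_real r *\<^sub>C x = r *\<^sub>R x"
    and norm_scaleC: "norm (a *\<^sub>C x) = cmod a * norm x"

instantiation complex :: complex_banach
begin

definition scaleC_complex :: "complex \<Rightarrow> complex \<Rightarrow> complex"
  where "scaleC_complex a x = a * x"

instance
  by standard (simp_all add: scaleC_complex_def algebra_simps norm_mult scaleR_conv_of_real)

end

definition bounded_clinear :: "('a::complex_banach \<Rightarrow> 'a) \<Rightarrow> bool"
  where "bounded_clinear T \<longleftrightarrow> bounded_linear T \<and> (\<forall>c x. T (c *\<^sub>C x) = c *\<^sub>C T x)"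

definition resolvent_set :: "('a::complex_banach \<Rightarrow> 'a) \<Rightarrow> complex set"
  where "resolvent_set T =
    {z. \<exists>S. bounded_clinear S \<and> (\<forall>x. S (z *\<^sub>C x - T x) = x) \<and> (\<forall>x. z *\<^sub>C S x - T (S x) = x)}"

definition op_spectrum :: "('a::complex_banach \<Rightarrow> 'a) \<Rightarrow> complex set"
  where "op_spectrum T = - resolvent_set T"

text \<open>Only meaningful for points of the resolvent set, where the function inverse below is the
  two-sided bounded inverse.\<close>

definition resolvent :: "complex \<Rightarrow> ('a::complex_banach \<Rightarrow> 'a) \<Rightarrow> 'a \<Rightarrow> 'a"
  where "resolvent z T = inv (\<lambda>x. z *\<^sub>C x - T x)"

text \<open>Functions on the half-open interval from 0 to pi are total functions on the reals whose
  values outside that interval are never used.  For \<open>s < m pi\<close> the set below may be empty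
  and the infimum is then unspecified.\<close>

definition right_inverse :: "(real \<Rightarrow> real) \<Rightarrow> real \<Rightarrow> real"
  where "right_inverse m s = Inf {\<epsilon>\<in>{0<..pi}. m \<epsilon> \<le> s}"

definition reciprocally_positive_increase :: "(real \<Rightarrow> real) \<Rightarrow> bool"
  where "reciprocally_positive_increase m \<longleftrightarrow>
    (\<exists>c\<^sub>0\<in>{0<..1}. \<exists>\<alpha>>0. \<exists>\<epsilon>\<^sub>0\<in>{0<..pi}.
      \<forall>t\<ge>1. \<forall>\<epsilon>\<in>{0<..\<epsilon>\<^sub>0}. m (\<epsilon> / t) / m \<epsilon> \<ge> c\<^sub>0 * t powr \<alpha>)"

end

theory Submission
  imports Defs
begin

text \<open>A point \<open>z\<close> of the spectrum satisfies
  \<open>\<bar>z\<bar>\<^sup>n \<bar>1 - z\<bar> \<le> \<parallel>T\<^sup>n (I - T)\<parallel>\<close>, so the rate assumption bounds the left-hand side by a multiple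
  of \<open>m\<^sup>-\<^sup>1 (c n)\<close>. The lower bound on \<open>1 / dist\<close> supplies such a \<open>z\<close> within \<open>2 / (\<delta> m \<epsilon>)\<close> of some
  \<open>e\<^sup>i\<^sup>\<theta>\<close> with \<open>\<epsilon> \<le> \<bar>\<theta>\<bar>\<close>. If \<open>\<epsilon> m \<epsilon>\<close> is large, then \<open>\<bar>1 - z\<bar>\<close> is at least \<open>\<epsilon> / 6\<close>, and for \<open>n\<close>
  about \<open>2 m \<epsilon> / c\<close> the power \<open>\<bar>z\<bar>\<^sup>n\<close> stays above a constant; hence \<open>m\<^sup>-\<^sup>1 (c n) > \<epsilon> / q\<close> for a
  fixed \<open>q\<close>, that is, \<open>m (\<epsilon> / q) > c n \<ge> 2 m \<epsilon>\<close>. If \<open>\<epsilon> m \<epsilon>\<close> is bounded, the same doubling follows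
  from \<open>m \<epsilon> \<ge> 1 / \<epsilon>\<close>, which holds because \<open>1\<close> is in the spectrum. Iterating the doubling gives
  reciprocally positive increase with exponent \<open>ln 2 / ln q\<close>.\<close>

section \<open>Complex scalar multiplication and bounded complex-linear operators\<close>

lemma scaleC_one: "1 *\<^sub>C x = (x :: 'a::complex_banach)"
  using scaleC_of_real[of 1 x] by simp

lemma scaleC_zero_right: "a *\<^sub>C 0 = (0 :: 'a::complex_banach)"
  using scaleC_add_right[of a 0 "0::'a"] by simp

lemma scaleC_zero_left: "0 *\<^sub>C x = (0 :: 'a::complex_banach)"
  using scaleC_of_real[of 0 x] by simp

lemma scaleC_minus_right: "a *\<^sub>C (- x) = - (a *\<^sub>C (x :: 'a::complex_banach))"
  using scaleC_add_right[of a x "-x"] by (simp add: scaleC_zero_right eq_neg_iff_add_eq_0 add.commute)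

lemma scaleC_diff_right: "a *\<^sub>C (x - y) = a *\<^sub>C x - a *\<^sub>C (y :: 'a::complex_banach)"
  using scaleC_add_right[of a x "-y"] by (simp add: scaleC_minus_right)

lemma scaleC_diff_left: "(a - b) *\<^sub>C x = a *\<^sub>C x - b *\<^sub>C (x :: 'a::complex_banach)"
  using scaleC_add_left[of "a - b" b x] by (simp add: algebra_simps)

lemma bounded_clinear_scaleC:
  assumes "bounded_clinear A"
  shows "bounded_clinear (\<lambda>x. a *\<^sub>C A x)"
proof -
  have A: "bounded_linear A" using assms by (simp add: bounded_clinear_def)
  have "bounded_linear (\<lambda>x::'a. a *\<^sub>C x)"
    by (rule bounded_linear_intro[of _ "cmod a"])
      (simp_all add: scaleC_add_right norm_scaleC scaleC_scaleC mult.commute flip: scaleC_of_real)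
  from bounded_linear_compose[OF this A] show ?thesis
    using assms by (simp add: bounded_clinear_def scaleC_scaleC mult.commute)
qed

lemma bounded_clinear_add:
  assumes "bounded_clinear A" "bounded_clinear B"
  shows "bounded_clinear (\<lambda>x. A x + B x)"
  using assms by (simp add: bounded_clinear_def bounded_linear_add scaleC_add_right)

lemma bounded_clinear_diff:
  assumes "bounded_clinear A" "bounded_clinear B"
  shows "bounded_clinear (\<lambda>x. A x - B x)"
  using assms by (simp add: bounded_clinear_def bounded_linear_sub scaleC_diff_right)

lemma bounded_clinear_compose:
  assumes "bounded_clinear A" "bounded_clinear B"
  shows "bounded_clinear (\<lambda>x. A (B x))"
  using assms by (auto simp: bounded_clinear_def intro: bounded_linear_compose)

lemma bounded_clinear_ident: "bounded_clinear (\<lambda>x. x)"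
  by (simp add: bounded_clinear_def bounded_linear_ident)

lemma bounded_clinear_funpow:
  assumes "bounded_clinear A"
  shows "bounded_clinear (A ^^ n)"
proof (induction n)
  case 0
  show ?case using bounded_clinear_ident by (simp add: id_def)
next
  case (Suc n)
  show ?case using bounded_clinear_compose[OF assms Suc] by (simp add: o_def)
qed

lemma bounded_clinear_linear:
  assumes "bounded_clinear A"
  shows "linear A"
  using assms by (simp add: bounded_clinear_def bounded_linear.linear)

lemma bounded_clinear_norm_le:
  assumes "bounded_clinear A"
  shows "norm (A x) \<le> onorm A * norm x"
  using assms by (simp add: bounded_clinear_def onorm)

section \<open>Resolvent sets, invertibility criteria and spectral lower bounds for norms\<close>

lemma resolvent_setI:
  assumes "bounded_clinear L"
    and L: "\<And>x. L (z *\<^sub>C x - T x) = x"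
    and R: "\<And>x. z *\<^sub>C R x - T (R x) = x"
  shows "z \<in> resolvent_set T"
proof -
  \<comment> \<open>A left inverse and a right inverse coincide, so boundedness and complex
    linearity have to be known for \<open>L\<close> only.\<close>
  have "L x = R x" for x using L[of "R x"] by (simp add: R)
  then show ?thesis using assms unfolding resolvent_set_def by auto
qed

lemma resolvent_setE:
  assumes "z \<in> resolvent_set T"
  obtains "bounded_clinear (resolvent z T)"
    and "\<And>x. resolvent z T (z *\<^sub>C x - T x) = x"
    and "\<And>x. z *\<^sub>C resolvent z T x - T (resolvent z T x) = x"
proof -
  obtain S where S: "bounded_clinear S" "\<And>x. S (z *\<^sub>C x - T x) = x"
    "\<And>x. z *\<^sub>C S x - T (S x) = x"
    using assms unfolding resolvent_set_def by blast
  have "resolvent z T = S"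
    unfolding resolvent_def by (rule inv_equality) (simp_all add: S)
  then show thesis using S that by simp
qed

text \<open>In place of summing the Neumann series, \<open>w x - A x = y\<close> is read as a
  fixed-point equation for \<open>x \<mapsto> (y + A x) / w\<close>, a contraction with factor
  \<open>onorm A / cmod w\<close>. Uniqueness of solutions makes the solution operator linear, and
  the triangle inequality bounds it by \<open>1 / (cmod w - onorm A)\<close>.\<close>

lemma resolvent_setI_onorm_less:
  fixes A :: "'a::complex_banach \<Rightarrow> 'a"
  assumes A: "bounded_clinear A" and less: "onorm A < cmod w"
  shows "w \<in> resolvent_set A"
proof -
  have ge0: "0 \<le> onorm A"
    using A by (simp add: bounded_clinear_def onorm_pos_le)
  have w0: "w \<noteq> 0" using ge0 less by auto
  have lin: "linear A" using A by (rule bounded_clinear_linear)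
  have AC: "A (a *\<^sub>C x) = a *\<^sub>C A x" for a x using A by (simp add: bounded_clinear_def)
  have solve: "\<exists>!x. w *\<^sub>C x - A x = y" for y
  proof -
    have "\<exists>!x. inverse w *\<^sub>C (y + A x) = x"
    proof (rule banach_fix_type[of "onorm A / cmod w"], goal_cases)
      case 3
      show ?case
      proof (intro allI)
      fix x x' :: 'a
      have "dist (inverse w *\<^sub>C (y + A x)) (inverse w *\<^sub>C (y + A x'))
          = cmod (inverse w) * norm (A (x - x'))"
        by (simp add: dist_norm linear_diff[OF lin] flip: scaleC_diff_right norm_scaleC)
      also have "\<dots> \<le> cmod (inverse w) * (onorm A * norm (x - x'))"
        by (intro mult_left_mono bounded_clinear_norm_le A) simp
      finally show "dist (inverse w *\<^sub>C (y + A x)) (inverse w *\<^sub>C (y + A x'))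
          \<le> onorm A / cmod w * dist x x'"
        by (simp add: dist_norm norm_inverse divide_inverse mult_ac)
      qed
    qed (use ge0 less w0 in auto)
    moreover have "inverse w *\<^sub>C (y + A x) = x \<longleftrightarrow> w *\<^sub>C x - A x = y" for x
    proof -
      have "inverse w *\<^sub>C (y + A x) = x \<longleftrightarrow> y + A x = w *\<^sub>C x"
        using w0 by (metis (no_types) scaleC_one scaleC_scaleC left_inverse right_inverse)
      then show ?thesis by (metis add_diff_cancel_right' diff_add_cancel)
    qed
    ultimately show ?thesis by simp
  qed
  define V where "V y = (THE x. w *\<^sub>C x - A x = y)" for y
  have V: "w *\<^sub>C V y - A (V y) = y" for y
    unfolding V_def by (rule theI'[OF solve])
  have VI: "V y = x" if "w *\<^sub>C x - A x = y" for x y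
    using solve V that by blast
  have VA: "V (w *\<^sub>C x - A x) = x" for x by (rule VI) simp
  have Vadd: "V (x + y) = V x + V y" for x y
  proof (rule VI)
    have "w *\<^sub>C (V x + V y) - A (V x + V y) = (w *\<^sub>C V x - A (V x)) + (w *\<^sub>C V y - A (V y))"
      by (simp add: scaleC_add_right linear_add[OF lin])
    then show "w *\<^sub>C (V x + V y) - A (V x + V y) = x + y" by (simp add: V)
  qed
  have VC: "V (a *\<^sub>C x) = a *\<^sub>C V x" for a x
  proof (rule VI)
    have "w *\<^sub>C (a *\<^sub>C V x) - A (a *\<^sub>C V x) = a *\<^sub>C (w *\<^sub>C V x - A (V x))"
      by (simp add: AC scaleC_diff_right scaleC_scaleC mult.commute)
    then show "w *\<^sub>C (a *\<^sub>C V x) - A (a *\<^sub>C V x) = a *\<^sub>C x" by (simp add: V)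
  qed
  have Vnorm: "norm (V x) \<le> norm x * inverse (cmod w - onorm A)" for x
  proof -
    have "cmod w * norm (V x) = norm (x + A (V x))"
      using V[of x] by (metis diff_add_cancel norm_scaleC)
    also have "\<dots> \<le> norm x + onorm A * norm (V x)"
      using norm_triangle_ineq[of x "A (V x)"] bounded_clinear_norm_le[OF A, of "V x"] by linarith
    finally show ?thesis using less by (simp add: field_simps)
  qed
  have "bounded_clinear V"
    unfolding bounded_clinear_def
  proof (intro conjI allI VC)
    show "bounded_linear V"
      by (rule bounded_linear_intro[OF Vadd _ Vnorm]) (simp add: VC flip: scaleC_of_real)
  qed
  then show ?thesis by (rule resolvent_setI) (fact VA, fact V)
qed

text \<open>With \<open>S = resolvent l T\<close> one has
  \<open>z - T = (l - T) (I - (l - z) S)\<close>. If the product were below 1, the second factor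
  would be invertible by the previous criterion, and so would \<open>z - T\<close>.\<close>

lemma one_le_dist_spectrum_mult_onorm_resolvent:
  assumes T: "bounded_clinear T" and l: "l \<in> resolvent_set T" and z: "z \<in> op_spectrum T"
  shows "1 \<le> dist l z * onorm (resolvent l T)"
proof (rule ccontr)
  assume "\<not> ?thesis"
  define S where "S = resolvent l T"
  have S: "bounded_clinear S" "\<And>x. S (l *\<^sub>C x - T x) = x" "\<And>x. l *\<^sub>C S x - T (S x) = x"
    unfolding S_def by (rule resolvent_setE[OF l]; blast)+
  have linS: "linear S" by (rule bounded_clinear_linear[OF S(1)])
  define A where "A x = (l - z) *\<^sub>C S x" for x
  have A: "bounded_clinear A"
    unfolding A_def by (rule bounded_clinear_scaleC[OF S(1)])
  have "onorm A \<le> cmod (l - z) * onorm S"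
  proof (rule onorm_bound)
    show "0 \<le> cmod (l - z) * onorm S"
      using S(1) by (simp add: bounded_clinear_def onorm_pos_le)
    fix x show "norm (A x) \<le> cmod (l - z) * onorm S * norm x"
      by (simp add: A_def norm_scaleC mult.assoc mult_left_mono bounded_clinear_norm_le[OF S(1)])
  qed
  with \<open>\<not> ?thesis\<close> have "onorm A < cmod 1" by (simp add: S_def dist_norm)
  from resolvent_setI_onorm_less[OF A this] obtain V where V: "bounded_clinear V"
    "\<And>x. V (x - A x) = x" "\<And>x. V x - A (V x) = x"
    by (rule resolvent_setE) (simp add: scaleC_one)
  have split: "z *\<^sub>C x - T x = (l *\<^sub>C x - T x) - (l - z) *\<^sub>C x" for x
    by (simp add: scaleC_diff_left)
  have SC: "S (a *\<^sub>C x) = a *\<^sub>C S x" for a x using S(1) by (simp add: bounded_clinear_def)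
  have "z \<in> resolvent_set T"
  proof (rule resolvent_setI[where L = "\<lambda>x. V (S x)" and R = "\<lambda>x. S (V x)"])
    show "V (S (z *\<^sub>C x - T x)) = x" for x
      using linear_diff[OF linS, of "l *\<^sub>C x - T x" "(l - z) *\<^sub>C x"]
      unfolding split S(2) SC by (simp add: V flip: A_def)
    show "z *\<^sub>C S (V x) - T (S (V x)) = x" for x
      unfolding split S(3) by (simp add: V flip: A_def)
  qed (rule bounded_clinear_compose[OF V(1) S(1)])
  then show False using z by (simp add: op_spectrum_def)
qed

text \<open>\<open>Q\<close> is the sum of \<open>z ^ (n - 1 - j) T ^ j\<close> over
  \<open>j < n\<close>, built by the recursion \<open>Q' = z Q + T ^ n\<close>. Both orders of the
  product are recorded because invertibility of \<open>z - T\<close> is later tested from either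
  side.\<close>

lemma power_diff_factorization:
  assumes T: "bounded_clinear T"
  shows "\<exists>Q. bounded_clinear Q \<and> (\<forall>x. Q (z *\<^sub>C x - T x) = z ^ n *\<^sub>C x - (T ^^ n) x) \<and>
    (\<forall>x. z *\<^sub>C Q x - T (Q x) = z ^ n *\<^sub>C x - (T ^^ n) x)"
proof (induction n)
  case 0
  show ?case
    \<comment> \<open>The zero operator is written as a multiple of the identity, so that
      \<open>bounded_clinear_scaleC\<close> applies to it.\<close>
    by (rule exI[of _ "\<lambda>x. 0 *\<^sub>C x"])
      (use bounded_clinear_scaleC[OF bounded_clinear_ident, of 0] linear_0[OF bounded_clinear_linear[OF T]]
        in \<open>simp add: scaleC_one scaleC_zero_left scaleC_zero_right\<close>)
next
  case (Suc n)
  then obtain Q where Q: "bounded_clinear Q"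
    "\<And>x. Q (z *\<^sub>C x - T x) = z ^ n *\<^sub>C x - (T ^^ n) x"
    "\<And>x. z *\<^sub>C Q x - T (Q x) = z ^ n *\<^sub>C x - (T ^^ n) x" by blast
  have Tn: "bounded_clinear (T ^^ n)" by (rule bounded_clinear_funpow[OF T])
  note lin = bounded_clinear_linear[OF T] bounded_clinear_linear[OF Tn]
  have C: "T (a *\<^sub>C x) = a *\<^sub>C T x" "(T ^^ n) (a *\<^sub>C x) = a *\<^sub>C (T ^^ n) x" for a x
    using T Tn by (simp_all add: bounded_clinear_def)
  have "z *\<^sub>C (z *\<^sub>C Q x + (T ^^ n) x) - T (z *\<^sub>C Q x + (T ^^ n) x)
      = z *\<^sub>C (z *\<^sub>C Q x - T (Q x)) + z *\<^sub>C (T ^^ n) x - (T ^^ Suc n) x" for x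
    by (simp add: scaleC_add_right scaleC_diff_right C linear_add[OF lin(1)])
  moreover have "z *\<^sub>C Q (z *\<^sub>C x - T x) + (T ^^ n) (z *\<^sub>C x - T x)
      = z ^ Suc n *\<^sub>C x - (T ^^ Suc n) x" for x
    by (simp add: Q(2) scaleC_diff_right C linear_diff[OF lin(2)] scaleC_scaleC funpow_swap1)
  ultimately show ?case
    using bounded_clinear_add[OF bounded_clinear_scaleC[OF Q(1), of z] Tn]
    by (intro exI[of _ "\<lambda>x. z *\<^sub>C Q x + (T ^^ n) x"]) (simp add: Q(3) scaleC_diff_right scaleC_scaleC)
qed

text \<open>This is spectral mapping for the polynomial \<open>z ^ n * (1 - z)\<close>. If its value
  \<open>w\<close> exceeded the norm of \<open>P\<close> in modulus, \<open>w - P\<close> would have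
  an inverse \<open>V\<close>. Since \<open>w - P\<close> factors through \<open>z - T\<close> on
  both sides with cofactor \<open>Q\<close>, the operators \<open>V Q\<close> and \<open>Q V\<close>
  would be a left and a right inverse of \<open>z - T\<close>.\<close>

lemma spectrum_norm_le:
  assumes T: "bounded_clinear T" and z: "z \<in> op_spectrum T"
  shows "cmod z ^ n * cmod (1 - z) \<le> onorm (\<lambda>x. (T ^^ n) (x - T x))"
proof (rule ccontr)
  assume neg: "\<not> ?thesis"
  define P where "P = (\<lambda>x. (T ^^ n) (x - T x))"
  define w where "w = z ^ n * (1 - z)"
  have Tn: "bounded_clinear (T ^^ n)" by (rule bounded_clinear_funpow[OF T])
  have P: "bounded_clinear P"
    unfolding P_def by (intro bounded_clinear_compose[OF Tn] bounded_clinear_diff bounded_clinear_ident T)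
  have "onorm P < cmod w"
    using neg by (simp add: P_def w_def norm_mult norm_power)
  then have "w \<in> resolvent_set P" by (rule resolvent_setI_onorm_less[OF P])
  then obtain V where V: "bounded_clinear V" "\<And>x. V (w *\<^sub>C x - P x) = x"
    "\<And>x. w *\<^sub>C V x - P (V x) = x" by (rule resolvent_setE) blast
  obtain Q1 where Q1: "bounded_clinear Q1"
    "\<And>x. Q1 (z *\<^sub>C x - T x) = z ^ n *\<^sub>C x - (T ^^ n) x"
    "\<And>x. z *\<^sub>C Q1 x - T (Q1 x) = z ^ n *\<^sub>C x - (T ^^ n) x"
    using power_diff_factorization[OF T] by blast
  obtain Q2 where Q2: "bounded_clinear Q2"
    "\<And>x. Q2 (z *\<^sub>C x - T x) = z ^ Suc n *\<^sub>C x - (T ^^ Suc n) x"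
    "\<And>x. z *\<^sub>C Q2 x - T (Q2 x) = z ^ Suc n *\<^sub>C x - (T ^^ Suc n) x"
    using power_diff_factorization[OF T] by blast
  define Q where "Q x = Q1 x - Q2 x" for x
  have Q: "bounded_clinear Q"
    unfolding Q_def by (rule bounded_clinear_diff[OF Q1(1) Q2(1)])
  \<comment> \<open>Writing the polynomial as \<open>z ^ n - z ^ Suc n\<close> reduces its
    factorization to two differences of powers.\<close>
  have wP: "w *\<^sub>C x - P x = (z ^ n *\<^sub>C x - (T ^^ n) x) - (z ^ Suc n *\<^sub>C x - (T ^^ Suc n) x)" for x
    by (simp add: w_def P_def linear_diff[OF bounded_clinear_linear[OF Tn]] funpow_swap1
        scaleC_diff_left algebra_simps)
  have QL: "Q (z *\<^sub>C x - T x) = w *\<^sub>C x - P x" for x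
    by (simp add: Q_def Q1(2) Q2(2) wP)
  have QR: "z *\<^sub>C Q x - T (Q x) = w *\<^sub>C x - P x" for x
  proof -
    have "z *\<^sub>C Q x - T (Q x) = (z *\<^sub>C Q1 x - T (Q1 x)) - (z *\<^sub>C Q2 x - T (Q2 x))"
      by (simp add: Q_def scaleC_diff_right linear_diff[OF bounded_clinear_linear[OF T]])
    then show ?thesis by (simp add: Q1(3) Q2(3) wP)
  qed
  have "z \<in> resolvent_set T"
    by (rule resolvent_setI[where L = "\<lambda>x. V (Q x)" and R = "\<lambda>x. Q (V x)"])
      (simp_all add: QL QR V bounded_clinear_compose[OF V(1) Q])
  then show False using z by (simp add: op_spectrum_def)
qed

section \<open>Growth from doubling, and the right-inverse of \<open>m\<close>\<close>

lemma reciprocally_positive_increaseI: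
  assumes pos: "\<And>\<epsilon>. 0 < \<epsilon> \<Longrightarrow> \<epsilon> \<le> pi \<Longrightarrow> 0 < m \<epsilon>"
    and decr: "antimono_on {0<..pi} m"
    and e0: "0 < e0" "e0 \<le> pi" and q: "1 < q"
    and double: "\<And>\<epsilon>. 0 < \<epsilon> \<Longrightarrow> \<epsilon> \<le> e0 \<Longrightarrow> 2 * m \<epsilon> \<le> m (\<epsilon> / q)"
  shows "reciprocally_positive_increase m"
proof -
  \<comment> \<open>The exponent for which one factor \<open>q\<close> in the argument corresponds
    to one doubling of \<open>m\<close>.\<close>
  define \<alpha> where "\<alpha> = ln 2 / ln q"
  have \<alpha>: "0 < \<alpha>" using q by (simp add: \<alpha>_def)
  have q\<alpha>: "q powr \<alpha> = 2" using q by (simp add: \<alpha>_def powr_def)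
  have iter: "2 ^ k * m \<epsilon> \<le> m (\<epsilon> / q ^ k)" if "0 < \<epsilon>" "\<epsilon> \<le> e0" for k \<epsilon>
  proof (induction k)
    case (Suc k)
    have "\<epsilon> / q ^ k \<le> \<epsilon>" using q that by (simp add: field_simps)
    then have "2 * m (\<epsilon> / q ^ k) \<le> m (\<epsilon> / q ^ k / q)"
      using q that by (intro double) auto
    with Suc show ?case by (simp add: field_simps)
  qed simp
  have "1/2 * t powr \<alpha> \<le> m (\<epsilon> / t) / m \<epsilon>" if t: "1 \<le> t" and e: "0 < \<epsilon>" "\<epsilon> \<le> e0" for t \<epsilon>
  proof -
    \<comment> \<open>Thus \<open>q ^ k \<le> t < q ^ (k + 1)\<close>. The lower end lets
      monotonicity pass from \<open>q ^ k\<close> to \<open>t\<close>; the upper end gives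
      \<open>t powr \<alpha> \<le> 2 ^ (k + 1)\<close>, and the surplus factor 2 is the constant
      1/2.\<close>
    define k where "k = nat \<lfloor>log q t\<rfloor>"
    have k: "real k \<le> log q t" "log q t < real k + 1"
      using q t by (simp_all add: k_def zero_le_log_cancel_iff)
    have qk: "q ^ k \<le> t"
      using k(1) q t by (simp add: le_log_iff powr_realpow)
    have "t \<le> q powr (real k + 1)"
      using k(2) q t by (simp add: log_less_iff)
    then have "t powr \<alpha> \<le> (q powr (real k + 1)) powr \<alpha>"
      using t \<alpha> by (intro powr_mono2) auto
    also have "\<dots> = (q powr \<alpha>) powr (real (Suc k))"
      by (simp add: powr_powr mult.commute add.commute)
    also have "\<dots> = 2 * 2 ^ k" by (subst powr_realpow) (simp_all add: q\<alpha>)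
    finally have 1: "1/2 * t powr \<alpha> \<le> 2 ^ k" by simp
    have "2 ^ k * m \<epsilon> \<le> m (\<epsilon> / q ^ k)" by (rule iter[OF e])
    also have "\<dots> \<le> m (\<epsilon> / t)"
    proof (rule monotone_onD[OF decr])
      have "\<epsilon> / q ^ k \<le> \<epsilon>" "\<epsilon> / t \<le> \<epsilon>" using q e t by (simp_all add: field_simps)
      then show "\<epsilon> / t \<in> {0<..pi}" "\<epsilon> / q ^ k \<in> {0<..pi}" using e e0 q t by auto
      show "\<epsilon> / t \<le> \<epsilon> / q ^ k" using qk q e t by (intro divide_left_mono) auto
    qed
    finally have "2 ^ k \<le> m (\<epsilon> / t) / m \<epsilon>" using pos[of \<epsilon>] e e0 by (simp add: field_simps)
    with 1 show ?thesis by linarith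
  qed
  then show ?thesis
    unfolding reciprocally_positive_increase_def
    using \<alpha> e0 by (intro bexI[of _ "1/2"] exI[of _ \<alpha>] conjI bexI[of _ e0]) auto
qed

text \<open>The hypothesis puts \<open>pi\<close> into the set, so the infimum is not the
  unspecified one of the empty set.\<close>

lemma right_inverse_nonneg:
  assumes "m pi \<le> s"
  shows "0 \<le> right_inverse m s"
  unfolding right_inverse_def using assms by (intro cInf_greatest) (auto intro!: exI[of _ pi])

lemma less_right_inverseD:
  assumes "r < right_inverse m s" "0 < r" "r \<le> pi"
  shows "s < m r"
proof (rule ccontr)
  assume "\<not> s < m r"
  then have "right_inverse m s \<le> r"
    unfolding right_inverse_def using assms by (intro cInf_lower bdd_belowI[of _ 0]) auto
  with assms show False by simp
qed

section \<open>Elementary estimates on the unit circle and for powers near 1\<close>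

lemma norm_one_minus_cis: "cmod (1 - cis \<theta>) = 2 * \<bar>sin (\<theta> / 2)\<bar>"
  using dist_exp_i_1[of \<theta>] by (simp add: cis_conv_exp norm_minus_commute)

lemma norm_one_minus_cis_le: "cmod (1 - cis \<theta>) \<le> \<bar>\<theta>\<bar>"
  using abs_sin_x_le_abs_x[of "\<theta> / 2"] by (simp add: norm_one_minus_cis)

text \<open>With \<open>x = \<bar>\<theta>\<bar> / 2 \<le> 2\<close>, Taylor's formula gives
  \<open>sin x \<ge> x - x ^ 3 / 6 \<ge> x - 4 * x / 6 = x / 3\<close>.\<close>

lemma norm_one_minus_cis_ge:
  assumes "\<bar>\<theta>\<bar> \<le> pi"
  shows "\<bar>\<theta>\<bar> / 3 \<le> cmod (1 - cis \<theta>)"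
proof -
  define x where "x = \<bar>\<theta> / 2\<bar>"
  have x: "0 \<le> x" "x \<le> 2" using assms pi_less_4 by (auto simp: x_def)
  have "\<bar>sin x - x\<bar> \<le> x ^ 3 / 6"
    using Maclaurin_sin_bound[of x 3] x
    by (simp add: numeral_3_eq_3 sin_coeff_def fact_numeral divide_simps)
  moreover have "x ^ 3 \<le> x * 4"
  proof -
    have "x\<^sup>2 \<le> 2\<^sup>2" using x by (intro power_mono) auto
    then have "x * x\<^sup>2 \<le> x * 4" using x by (intro mult_left_mono) auto
    then show ?thesis by (simp add: power2_eq_square power3_eq_cube mult.assoc)
  qed
  ultimately have "x / 3 \<le> \<bar>sin x\<bar>" by linarith
  moreover have "\<bar>sin x\<bar> = \<bar>sin (\<theta> / 2)\<bar>" by (auto simp: x_def abs_if)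
  ultimately show ?thesis by (simp add: norm_one_minus_cis x_def)
qed

text \<open>On this range \<open>ln (1 - x) \<ge> - x - 2 * x ^ 2\<close>, and
  \<open>x ^ 2 \<le> x / 2\<close> turns the right-hand side into \<open>- 2 * x\<close>.\<close>

lemma power_one_minus_ge_exp:
  fixes x :: real
  assumes "0 \<le> x" "x \<le> 1/2"
  shows "exp (- (2 * real n * x)) \<le> (1 - x) ^ n"
proof -
  have "x\<^sup>2 \<le> x / 2" using assms by (simp add: power2_eq_square mult_left_mono[of x "1/2" x, simplified])
  then have "- (2 * x) \<le> ln (1 - x)"
    using ln_one_minus_pos_lower_bound[OF assms] by simp
  then have "real n * - (2 * x) \<le> real n * ln (1 - x)" by (rule mult_left_mono) simp
  then have "exp (- (2 * real n * x)) \<le> exp (real n * ln (1 - x))" by simp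
  also have "\<dots> = (1 - x) ^ n" using assms by (simp add: exp_of_nat_mult)
  finally show ?thesis .
qed

section \<open>From the spectral bound to the doubling of \<open>m\<close>\<close>

theorem proposition4p1:
  fixes T :: "'a::complex_banach \<Rightarrow> 'a" and m :: "real \<Rightarrow> real" and \<delta> c :: real
  assumes T: "bounded_clinear T"
    and spec: "{1} \<subseteq> op_spectrum T \<inter> sphere 0 1" "op_spectrum T \<inter> sphere 0 1 \<subseteq> ball 0 1 \<union> {1}"
    and m_pos: "\<And>\<epsilon>. 0 < \<epsilon> \<Longrightarrow> \<epsilon> \<le> pi \<Longrightarrow> 0 < m \<epsilon>"
    and m_cont: "continuous_on {0<..pi} m"
    and m_decr: "antimono_on {0<..pi} m"
    and upper: "\<And>\<theta>. 0 < \<bar>\<theta>\<bar> \<Longrightarrow> \<bar>\<theta>\<bar> \<le> pi \<Longrightarrow> onorm (resolvent (cis \<theta>) T) \<le> m \<bar>\<theta>\<bar>"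
    and \<delta>: "0 < \<delta>" "\<delta> \<le> 1"
    and lower: "\<And>\<epsilon>. 0 < \<epsilon> \<Longrightarrow> \<epsilon> \<le> pi \<Longrightarrow>
      (SUP \<theta>\<in>{\<theta>. \<epsilon> \<le> \<bar>\<theta>\<bar> \<and> \<bar>\<theta>\<bar> \<le> pi}. 1 / infdist (cis \<theta>) (op_spectrum T)) \<ge> \<delta> * m \<epsilon>"
    and c: "0 < c"
    and rate: "(\<lambda>n::nat. onorm (\<lambda>x. (T ^^ n) (x - T x))) \<in> O(\<lambda>n. right_inverse m (c * real n))"
  shows "reciprocally_positive_increase m"
proof -
  have one: "1 \<in> op_spectrum T" using spec(1) by auto
  have cis_res: "cis \<theta> \<in> resolvent_set T" if "0 < \<bar>\<theta>\<bar>" "\<bar>\<theta>\<bar> \<le> pi" for \<theta>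
  proof -
    \<comment> \<open>A spectral point on the unit circle is outside the open ball, so
      \<open>spec(2)\<close> leaves only 1.\<close>
    have "cmod (1 - cis \<theta>) \<noteq> 0" using norm_one_minus_cis_ge[of \<theta>] that by auto
    then show ?thesis using spec(2) by (auto simp: op_spectrum_def)
  qed
  have dist_ge: "1 \<le> dist (cis \<theta>) z * m \<bar>\<theta>\<bar>"
    if "0 < \<bar>\<theta>\<bar>" "\<bar>\<theta>\<bar> \<le> pi" "z \<in> op_spectrum T" for \<theta> z
    using one_le_dist_spectrum_mult_onorm_resolvent[OF T cis_res[OF that(1,2)] that(3)]
      mult_left_mono[OF upper[OF that(1,2)], of "dist (cis \<theta>) z"] by simp
  have m_ge: "1 / \<epsilon> \<le> m \<epsilon>" if "0 < \<epsilon>" "\<epsilon> \<le> pi" for \<epsilon>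
  proof -
    have "1 \<le> dist (cis \<epsilon>) 1 * m \<epsilon>" using dist_ge[of \<epsilon> 1] that one by simp
    also have "\<dots> \<le> \<epsilon> * m \<epsilon>"
      using norm_one_minus_cis_le[of \<epsilon>] that m_pos[OF that]
      by (intro mult_right_mono) (auto simp: dist_norm norm_minus_commute)
    finally show ?thesis using that by (simp add: field_simps)
  qed
  have near: "\<exists>\<theta> z. \<epsilon> \<le> \<bar>\<theta>\<bar> \<and> \<bar>\<theta>\<bar> \<le> pi \<and> z \<in> op_spectrum T \<and> dist (cis \<theta>) z < 2 / (\<delta> * m \<epsilon>)"
    if e: "0 < \<epsilon>" "\<epsilon> \<le> pi" for \<epsilon>
  proof -
    define E where "E = {\<theta>. \<epsilon> \<le> \<bar>\<theta>\<bar> \<and> \<bar>\<theta>\<bar> \<le> pi}"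
    have pos: "0 < m \<epsilon>" by (rule m_pos[OF e])
    \<comment> \<open>This keeps the distances away from 0: the real supremum is then over a bounded
      set, and no reciprocal takes the default value \<open>1 / 0 = 0\<close>.\<close>
    have inf_ge: "1 / m \<epsilon> \<le> infdist (cis \<theta>) (op_spectrum T)" if "\<theta> \<in> E" for \<theta>
    proof -
      have "1 / m \<epsilon> \<le> dist (cis \<theta>) z" if z: "z \<in> op_spectrum T" for z
      proof -
        have "m \<bar>\<theta>\<bar> \<le> m \<epsilon>"
          using \<open>\<theta> \<in> E\<close> e by (intro monotone_onD[OF m_decr]) (auto simp: E_def)
        then have "1 \<le> dist (cis \<theta>) z * m \<epsilon>"
          using dist_ge[OF _ _ z, of \<theta>] \<open>\<theta> \<in> E\<close> e
            mult_left_mono[of "m \<bar>\<theta>\<bar>" "m \<epsilon>" "dist (cis \<theta>) z"]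
          by (cases "\<theta> = 0") (auto simp: E_def)
        then show ?thesis using pos by (simp add: field_simps)
      qed
      then show ?thesis using one by (auto simp: infdist_def intro!: cINF_greatest)
    qed
    have bdd: "bdd_above ((\<lambda>\<theta>. 1 / infdist (cis \<theta>) (op_spectrum T)) ` E)"
    proof (rule bdd_aboveI2)
      fix \<theta> assume "\<theta> \<in> E"
      then have "1 / infdist (cis \<theta>) (op_spectrum T) \<le> 1 / (1 / m \<epsilon>)"
        using pos by (intro divide_left_mono inf_ge mult_pos_pos less_le_trans[OF _ inf_ge]) auto
      then show "1 / infdist (cis \<theta>) (op_spectrum T) \<le> m \<epsilon>" by simp
    qed
    have ne: "E \<noteq> {}" using e by (auto simp: E_def intro!: exI[of _ \<epsilon>])
    \<comment> \<open>Halving makes the bound strict, so some member of the family exceeds it; the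
      same strictness then yields a spectral point from the infimum.\<close>
    have "\<delta> * m \<epsilon> / 2 < (SUP \<theta>\<in>E. 1 / infdist (cis \<theta>) (op_spectrum T))"
      using lower[OF e] mult_pos_pos[OF \<delta>(1) pos] unfolding E_def by linarith
    then obtain \<theta> where \<theta>: "\<theta> \<in> E" "\<delta> * m \<epsilon> / 2 < 1 / infdist (cis \<theta>) (op_spectrum T)"
      unfolding less_cSUP_iff[OF ne bdd] by blast
    have "0 < infdist (cis \<theta>) (op_spectrum T)"
      using pos by (intro less_le_trans[OF _ inf_ge[OF \<theta>(1)]]) simp
    then have "infdist (cis \<theta>) (op_spectrum T) < 2 / (\<delta> * m \<epsilon>)"
      using \<theta>(2) \<delta> pos by (simp add: field_simps)
    then have "(INF z\<in>op_spectrum T. dist (cis \<theta>) z) < 2 / (\<delta> * m \<epsilon>)"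
      using one by (auto simp: infdist_def split: if_splits)
    moreover have "op_spectrum T \<noteq> {}" using one by auto
    moreover have "bdd_below (dist (cis \<theta>) ` op_spectrum T)"
      by (rule bdd_belowI2[of _ 0]) simp
    ultimately obtain z where "z \<in> op_spectrum T" "dist (cis \<theta>) z < 2 / (\<delta> * m \<epsilon>)"
      by (metis cINF_less_iff)
    then show ?thesis using \<theta>(1) by (auto simp: E_def)
  qed
  obtain K where K: "0 < K" and "\<forall>\<^sub>F n in sequentially.
      norm (onorm (\<lambda>x. (T ^^ n) (x - T x))) \<le> K * norm (right_inverse m (c * real n))"
    using landau_o.bigE[OF rate] by blast
  then obtain N where N: "\<And>n. N \<le> n \<Longrightarrow>
      norm (onorm (\<lambda>x. (T ^^ n) (x - T x))) \<le> K * norm (right_inverse m (c * real n))"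
    by (auto simp: eventually_sequentially)
  \<comment> \<open>Lower bound for \<open>(1 - x) ^ n\<close> below: there \<open>n * x \<le> (4 *
    m \<epsilon> / c) * (2 / (\<delta> * m \<epsilon>)) = 8 / (c * \<delta>)\<close>, and
    \<open>power_one_minus_ge_exp\<close> doubles the exponent.\<close>
  define B where "B = exp (- (16 / (c * \<delta>)))"
  have B: "0 < B" by (simp add: B_def)
  \<comment> \<open>The first summand serves the case of bounded
    \<open>\<epsilon> * m \<epsilon>\<close>, the second the spectral estimate.\<close>
  define q where "q = 24 / \<delta> + 12 * K / B"
  have q24: "24 / \<delta> \<le> q" and qK: "12 * K / B \<le> q" using \<delta> K B by (simp_all add: q_def)
  have "24 \<le> 24 / \<delta>" using \<delta> by (simp add: field_simps)
  then have q1: "1 < q" using q24 by linarith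
  \<comment> \<open>For \<open>m \<epsilon> \<ge> M\<close> the entries give, in order:
    \<open>x \<le> 1/2\<close>; room for the rounding in \<open>n\<close>; \<open>N \<le> n\<close>;
    a nonempty set in \<open>right_inverse\<close>; positivity of \<open>M\<close>.\<close>
  define M where "M = Max {4 / \<delta>, c, c * real N, m pi, 1}"
  have M: "4 / \<delta> \<le> M" "c \<le> M" "c * real N \<le> M" "m pi \<le> M" "1 \<le> M"
    by (simp_all add: M_def)
  \<comment> \<open>For \<open>\<epsilon> \<le> 1 / M\<close>, \<open>m_ge\<close> gives
    \<open>m \<epsilon> \<ge> 1 / \<epsilon> \<ge> M\<close>.\<close>
  define e0 where "e0 = min pi (1 / M)"
  have e0: "0 < e0" "e0 \<le> pi" using M(5) by (simp_all add: e0_def)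
  have "2 * m \<epsilon> \<le> m (\<epsilon> / q)" if e: "0 < \<epsilon>" "\<epsilon> \<le> e0" for \<epsilon>
  \<comment> \<open>The threshold 12 is chosen so that its failure means
    \<open>x = 2 / (\<delta> * m \<epsilon>) < \<epsilon> / 6\<close>.\<close>
  proof (cases "m \<epsilon> \<le> 12 / (\<delta> * \<epsilon>)")
    case True
    have "\<epsilon> / q \<le> \<epsilon>" using e q1 by (simp add: field_simps)
    then have "1 / (\<epsilon> / q) \<le> m (\<epsilon> / q)" using e e0 q1 by (intro m_ge) auto
    moreover have "2 * (12 / (\<delta> * \<epsilon>)) \<le> q / \<epsilon>"
      using divide_right_mono[OF q24, of \<epsilon>] e by simp
    ultimately show ?thesis using True by simp
  next
    case False
    have epi: "\<epsilon> \<le> pi" using e e0 by simp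
    have "\<epsilon> \<le> 1 / M" using e by (simp add: e0_def)
    then have "M \<le> 1 / \<epsilon>" using e M(5) by (simp add: field_simps)
    then have mM: "M \<le> m \<epsilon>" using m_ge[OF e(1) epi] by linarith
    have pos: "0 < m \<epsilon>" by (rule m_pos[OF e(1) epi])
    define x where "x = 2 / (\<delta> * m \<epsilon>)"
    have x0: "0 < x" using \<delta> pos by (simp add: x_def)
    have x2: "x \<le> 1/2"
    proof -
      have "4 / \<delta> \<le> m \<epsilon>" using M(1) mM by linarith
      then show ?thesis using \<delta> pos by (simp add: x_def field_simps)
    qed
    have x6: "x < \<epsilon> / 6" using False \<delta> pos e by (simp add: x_def field_simps)
    \<comment> \<open>The least \<open>n\<close> with \<open>c * n \<ge> 2 * m \<epsilon>\<close>;
      this 2 is the doubling factor.\<close>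
    define n where "n = nat \<lceil>2 * m \<epsilon> / c\<rceil>"
    have n1: "2 * m \<epsilon> \<le> c * real n"
    proof -
      have "2 * m \<epsilon> / c \<le> real n" unfolding n_def by linarith
      then show ?thesis using c by (simp add: field_simps)
    qed
    have n2: "real n \<le> 4 * m \<epsilon> / c"
    proof -
      have "1 \<le> m \<epsilon> / c" using M(2) mM c by (simp add: field_simps)
      moreover have "real n \<le> 2 * m \<epsilon> / c + 1"
        unfolding n_def using pos c by (simp add: of_nat_nat)
      ultimately show ?thesis by simp
    qed
    have "c * real N \<le> c * real n" using n1 mM M(3) pos by linarith
    then have nN: "N \<le> n" using c by simp
    have inv_nonneg: "0 \<le> right_inverse m (c * real n)"
      using n1 mM M(4) pos by (intro right_inverse_nonneg) linarith
    obtain \<theta> z where z: "\<epsilon> \<le> \<bar>\<theta>\<bar>" "\<bar>\<theta>\<bar> \<le> pi" "z \<in> op_spectrum T" "dist (cis \<theta>) z < x"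
      using near[OF e(1) epi] unfolding x_def by blast
    have "1 - x \<le> cmod z"
      using norm_triangle_ineq2[of "cis \<theta>" z] z(4) by (simp add: dist_norm)
    \<comment> \<open>The distance from 1 to \<open>cis \<theta>\<close> is at least
      \<open>\<epsilon> / 3\<close>, and moving to \<open>z\<close> loses less than
      \<open>\<epsilon> / 6\<close>.\<close>
    moreover have "\<epsilon> / 6 \<le> cmod (1 - z)"
      using norm_one_minus_cis_ge[OF z(2)] z x6
        norm_triangle_ineq[of "1 - z" "z - cis \<theta>"] by (simp add: dist_norm norm_minus_commute)
    moreover have "B \<le> (1 - x) ^ n"
    proof -
      have "real n * x \<le> 4 * m \<epsilon> / c * x" using n2 x0 by (intro mult_right_mono) auto
      also have "\<dots> = 8 / (c * \<delta>)" using pos by (simp add: x_def)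
      finally have "B \<le> exp (- (2 * real n * x))" by (simp add: B_def)
      then show ?thesis using power_one_minus_ge_exp[of x n] x0 x2 by linarith
    qed
    ultimately have "B * (\<epsilon> / 6) \<le> cmod z ^ n * cmod (1 - z)"
      using x2 e B order.trans[OF _ power_mono[of "1 - x" "cmod z" n]] by (intro mult_mono) auto
    also have "\<dots> \<le> onorm (\<lambda>x. (T ^^ n) (x - T x))" by (rule spectrum_norm_le[OF T z(3)])
    also have "\<dots> \<le> K * right_inverse m (c * real n)" using N[OF nN] inv_nonneg by simp
    finally have "B * \<epsilon> / (6 * K) \<le> right_inverse m (c * real n)" using K by (simp add: field_simps)
    moreover have "\<epsilon> / q < B * \<epsilon> / (6 * K)"
    proof -
      \<comment> \<open>Taking 12 instead of 6 in \<open>q\<close> gives the strict inequality that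
        \<open>less_right_inverseD\<close> requires.\<close>
      have "6 * K < B * q" using qK K B by (simp add: field_simps)
      then show ?thesis using e q1 K by (simp add: field_simps)
    qed
    ultimately have less: "\<epsilon> / q < right_inverse m (c * real n)" by simp
    have "0 < \<epsilon> / q" "\<epsilon> / q \<le> \<epsilon>" using e q1 by (simp_all add: field_simps)
    then have "c * real n < m (\<epsilon> / q)"
      by (intro less_right_inverseD[OF less]) (use epi in linarith)+
    then show ?thesis using n1 by simp
  qed
  then show ?thesis
    by (intro reciprocally_positive_increaseI[where q = q, OF _ m_decr e0 q1] m_pos)
qed

end
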